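(* Let $k\ge1$ be an integer. If $m\geq2$ and $n,d\geq k$, then all $k$-th roots of unity are eigenvalues of $\mathsf{RSK}_{m,n,d}$.
   Context: $\mathbb{N}=\{0,1,2,\dots\}$. RSK. A semistandard Young tableau is a filling of a Young diagram (English notation) by positive integers, weakly increasing along rows and strictly increasing down columns. Row insertion $P\leftarrow p$: if no label in the first row of $P$ exceeds $p$, append $p$ to the end of the first row; otherwise replace the leftmost occurrence of the smallest label $p'>p$ of the first row by $p$, and insert $p'$ in the same way into the tableau formed by the remaining rows. Inserting a biletter $(p|q)$ into a pair $(P,Q)$ of tableaux of the same shape yields $(P\leftarrow p,Q^\uparrow)$, where $Q^\uparrow$ is $Q$ with a new box labelled $q$ placed where $P\leftarrow p$ has a new box. For an $m\times n$ matrix $\alpha$ with entries in $\mathbb{N}$, list biletters by reading the entries of $\alpha$ down columns, columns from left to right, recording $\alpha_{i,j}$ copies of $(i|j)$. $\mathrm{RSK}(\alpha)=(P,Q)$ is the result of inserting these biletters successively into $(\emptyset,\emptyset)$. Operator. Let $R_{m,n}=\mathbb{C}[z_{ij}]_{1\le i\le m,1\le j\le n}$, $Z=[z_{ij}]$, and $z^\alpha=\prod_{i,j} z_{ij}^{\alpha_{i,j}}$. For semistandard $P,Q$ of the same shape, $[P|Q]\in R_{m,n}$ is the product over column positions $c$ of the minors of $Z$ whose row indices are the entries of the $c$-th column of $P$ and whose column indices are the entries of the $c$-th column of $Q$. Let $\mathsf{RSK}:R_{m,n}\to R_{m,n}$ be the linear map with $z^\alpha\mapsto[P|Q]$ where $(P,Q)=\mathrm{RSK}(\alpha)$.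 It preserves degree, and $\mathsf{RSK}_{m,n,d}$ denotes its restriction to the finite-dimensional space $R_{m,n,d}$ spanned by degree-$d$ monomials. *)

theory Defs
  imports
    Complex_Main
    "HOL-Library.Poly_Mapping"
    "Jordan_Normal_Form.Determinant"
begin

section \<open>Tableaux and RSK\<close>

text \<open>A tableau is the list of its rows, from top to bottom.\<close>

type_synonym tableau = "nat list list"

fun row_insert :: "tableau \<Rightarrow> nat \<Rightarrow> tableau" where
  "row_insert [] p = [[p]]"
| "row_insert (r # P) p =
    (if \<forall>x\<in>set r. x \<le> p then (r @ [p]) # P
     else let p' = Min {x \<in> set r. p < x};
              k = length (takeWhile (\<lambda>x. x \<noteq> p') r)
          in r[k := p] # row_insert P p')"

definition row_length :: "tableau \<Rightarrow> nat \<Rightarrow> nat" where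
  "row_length P i = (if i < length P then length (P ! i) else 0)"

text \<open>The row containing the box that is in \<open>P'\<close> but not in \<open>P\<close>; the two shapes differ
  in exactly one box whenever \<open>P' = row_insert P p\<close>.\<close>

definition new_box_row :: "tableau \<Rightarrow> tableau \<Rightarrow> nat" where
  "new_box_row P P' = (LEAST i. row_length P' i \<noteq> row_length P i)"

definition add_box :: "nat \<Rightarrow> nat \<Rightarrow> tableau \<Rightarrow> tableau" where
  "add_box i q Q = (if i < length Q then Q[i := Q ! i @ [q]] else Q @ [[q]])"

definition insert_biletter :: "tableau \<times> tableau \<Rightarrow> nat \<times> nat \<Rightarrow> tableau \<times> tableau" where
  "insert_biletter = (\<lambda>(P, Q) (p, q).
     let P' = row_insert P p in (P', add_box (new_box_row P P') q Q))"

text \<open>A matrix with entries in the natural numbers is a finitely supported function of its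
  (1-based) positions, so that it can be used directly as the exponent of a monomial.\<close>

type_synonym nat_matrix = "(nat \<times> nat) \<Rightarrow>\<^sub>0 nat"

definition biletters :: "nat \<Rightarrow> nat \<Rightarrow> nat_matrix \<Rightarrow> (nat \<times> nat) list" where
  "biletters m n \<alpha> =
     concat (map (\<lambda>j. concat (map (\<lambda>i. replicate (Poly_Mapping.lookup \<alpha> (i, j)) (i, j)) [1..<Suc m])) [1..<Suc n])"

definition RSK :: "nat \<Rightarrow> nat \<Rightarrow> nat_matrix \<Rightarrow> tableau \<times> tableau" where
  "RSK m n \<alpha> = foldl insert_biletter ([], []) (biletters m n \<alpha>)"


section \<open>The polynomial ring\<close>

text \<open>Complex polynomials in the variables \<open>z\<^sub>i\<^sub>j\<close>, as finitely supported functions from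
  exponents to coefficients; multiplication is convolution.\<close>

type_synonym mat_poly = "nat_matrix \<Rightarrow>\<^sub>0 complex"

definition z_var :: "nat \<Rightarrow> nat \<Rightarrow> mat_poly" where
  "z_var i j = Poly_Mapping.single (Poly_Mapping.single (i, j) 1) 1"

definition scale_poly :: "complex \<Rightarrow> mat_poly \<Rightarrow> mat_poly" where
  "scale_poly c f = Poly_Mapping.single 0 c * f"

definition poly_ring :: "nat \<Rightarrow> nat \<Rightarrow> mat_poly set" where
  "poly_ring m n = {f. \<forall>\<alpha>\<in>Poly_Mapping.keys f. Poly_Mapping.keys \<alpha> \<subseteq> {1..m} \<times> {1..n}}"

definition homogeneous_part :: "nat \<Rightarrow> nat \<Rightarrow> nat \<Rightarrow> mat_poly set" where
  "homogeneous_part m n d =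
     {f \<in> poly_ring m n. \<forall>\<alpha>\<in>Poly_Mapping.keys f. (\<Sum>x\<in>Poly_Mapping.keys \<alpha>. Poly_Mapping.lookup \<alpha> x) = d}"


section \<open>Bitableaux and the operator\<close>

definition tab_column :: "tableau \<Rightarrow> nat \<Rightarrow> nat list" where
  "tab_column P c = map (\<lambda>r. r ! c) (filter (\<lambda>r. c < length r) P)"

definition z_minor :: "nat list \<Rightarrow> nat list \<Rightarrow> mat_poly" where
  "z_minor us vs =
     det (mat (length us) (length vs) (\<lambda>(a, b). z_var (us ! a) (vs ! b)))"

text \<open>For a tableau, the first row has the maximal length, so its length is the number of
  columns.\<close>

definition bitableau :: "tableau \<Rightarrow> tableau \<Rightarrow> mat_poly" where
  "bitableau P Q = (\<Prod>c<row_length P 0. z_minor (tab_column P c) (tab_column Q c))"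

text \<open>Linear extension of \<open>z\<^sup>\<alpha> \<mapsto> [P|Q]\<close>, where \<open>(P, Q) = RSK(\<alpha>)\<close>. It is only meant to be
  applied to elements of \<^term>\<open>poly_ring m n\<close>.\<close>

definition RSK_op :: "nat \<Rightarrow> nat \<Rightarrow> mat_poly \<Rightarrow> mat_poly" where
  "RSK_op m n f =
     (\<Sum>\<alpha>\<in>Poly_Mapping.keys f. scale_poly (Poly_Mapping.lookup f \<alpha>) (case RSK m n \<alpha> of (P, Q) \<Rightarrow> bitableau P Q))"

text \<open>\<open>c\<close> is an eigenvalue of the restriction of the linear map \<open>T\<close> to the subspace \<open>V\<close>.\<close>

definition eigenvalue_on :: "mat_poly set \<Rightarrow> (mat_poly \<Rightarrow> mat_poly) \<Rightarrow> complex \<Rightarrow> bool" where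
  "eigenvalue_on V T c \<longleftrightarrow> (\<exists>f\<in>V. f \<noteq> 0 \<and> T f = scale_poly c f)"

end

theory Submission
  imports Defs
begin

(* Fix p = d - k and consider the monomials of row weight (d - 1, 1) and column weight
   (p + 1, 1, ..., 1) in the first two rows and k columns.  Let e_i (0 <= i < k) be the one
   containing the variable of row 2 and column i + 1.  If i < k - 1, the single 2 is bumped by the
   next 1, so RSK e_i = e_(i+1) - e_0, while RSK e_(k-1) = e_(k-1).  The characteristic polynomial
   on the span of the e_i is x^k - 1, and w is the eigenvalue of
   (w - 1) * (sum of w^(-i) e_i over i < k - 1) + w^2 e_(k-1), also if w = 1. *)

section \<open>Linearity of the operator\<close>

text \<open>Added indices have coefficient zero. Enlarging the index set lets the sums for
  \<open>f\<close>, \<open>g\<close> and \<open>f + g\<close> run over one common set, although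
  cancellation may shrink the keys of \<open>f + g\<close>.\<close>

lemma RSK_op_superset:
  assumes "finite S" "Poly_Mapping.keys f \<subseteq> S"
  shows "RSK_op m n f =
    (\<Sum>\<alpha>\<in>S. scale_poly (Poly_Mapping.lookup f \<alpha>) (case RSK m n \<alpha> of (P, Q) \<Rightarrow> bitableau P Q))"
  unfolding RSK_op_def using assms
  by (intro sum.mono_neutral_left) (auto simp: in_keys_iff scale_poly_def)

lemma RSK_op_add: "RSK_op m n (f + g) = RSK_op m n f + RSK_op m n g"
proof -
  let ?S = "Poly_Mapping.keys f \<union> Poly_Mapping.keys g"
  have "finite ?S" "Poly_Mapping.keys (f + g) \<subseteq> ?S" by (simp_all add: Poly_Mapping.keys_add)
  then show ?thesis
    by (simp add: RSK_op_superset[of ?S] lookup_add scale_poly_def single_add ring_distribs sum.distrib)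
qed

lemma RSK_op_zero: "RSK_op m n 0 = 0"
  by (simp add: RSK_op_def)

lemma RSK_op_sum: "finite I \<Longrightarrow> RSK_op m n (\<Sum>i\<in>I. f i) = (\<Sum>i\<in>I. RSK_op m n (f i))"
  by (induction I rule: finite_induct) (simp_all add: RSK_op_zero RSK_op_add)

lemma RSK_op_single:
  "RSK_op m n (Poly_Mapping.single \<alpha> c) = scale_poly c (case RSK m n \<alpha> of (P, Q) \<Rightarrow> bitableau P Q)"
  by (subst RSK_op_superset[of "{\<alpha>}"]) (auto simp: lookup_single split: if_splits)


section \<open>Monomials given by words\<close>

text \<open>The exponent matrix of a word of biletters. It forgets their order, so the two terms of
  a minor can be identified with basis monomials by comparing multisets.\<close>

definition word_matrix :: "(nat \<times> nat) list \<Rightarrow> nat_matrix" where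
  "word_matrix L = sum_list (map (\<lambda>x. Poly_Mapping.single x 1) L)"

lemma word_matrix_simps:
  "word_matrix [] = 0"
  "word_matrix (x # L) = Poly_Mapping.single x 1 + word_matrix L"
  "word_matrix (L @ L') = word_matrix L + word_matrix L'"
  by (simp_all add: word_matrix_def)

lemma lookup_word_matrix: "Poly_Mapping.lookup (word_matrix L) x = count_list L x"
  by (induction L) (auto simp: word_matrix_simps lookup_add lookup_single)

lemma keys_word_matrix: "Poly_Mapping.keys (word_matrix L) = set L"
  by (auto simp: in_keys_iff lookup_word_matrix count_list_0_iff)

lemma word_matrix_cong: "mset L = mset L' \<Longrightarrow> word_matrix L = word_matrix L'"
  by (rule poly_mapping_eqI) (metis lookup_word_matrix count_mset)

lemma prod_list_z_var:
  "prod_list (map (\<lambda>(i, j). z_var i j) L) = Poly_Mapping.single (word_matrix L) 1"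
  by (induction L) (auto simp: word_matrix_simps z_var_def mult_single)

text \<open>The exponents are the multiplicities of the letters, which sum to the length of the
  word.\<close>

lemma single_word_matrix_homogeneous:
  assumes "\<And>x. x \<in> set L \<Longrightarrow> x \<in> {1..m} \<times> {1..n}"
  shows "Poly_Mapping.single (word_matrix L) c \<in> homogeneous_part m n (length L)"
  using assms sum_count_set[of L "set L"]
  by (auto simp: homogeneous_part_def poly_ring_def keys_word_matrix lookup_word_matrix split: if_splits)

lemma homogeneous_part_add:
  assumes "f \<in> homogeneous_part m n d" "g \<in> homogeneous_part m n d"
  shows "f + g \<in> homogeneous_part m n d"
  using assms Poly_Mapping.keys_add[of f g] unfolding homogeneous_part_def poly_ring_def by blast

lemma homogeneous_part_sum:
  "finite I \<Longrightarrow> (\<And>i. i \<in> I \<Longrightarrow> f i \<in> homogeneous_part m n d) \<Longrightarrow>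
    (\<Sum>i\<in>I. f i) \<in> homogeneous_part m n d"
proof (induction I rule: finite_induct)
  case empty
  show ?case by (simp add: homogeneous_part_def poly_ring_def)
next
  case (insert i I)
  then show ?case by (simp add: homogeneous_part_add)
qed


section \<open>Insertion of a word with a single 2\<close>

lemma insert_one_one_row:
  assumes "length ys = a" "ys \<noteq> []"
  shows "insert_biletter ([replicate a 1], [ys]) (1, q) = ([replicate (Suc a) 1], [ys @ [q]])"
proof -
  have "new_box_row [replicate a 1] [replicate (Suc a) 1] = 0"
    unfolding new_box_row_def by (rule Least_equality) (auto simp: row_length_def)
  then show ?thesis
    using assms by (simp add: insert_biletter_def add_box_def replicate_append_same)
qed

text \<open>The empty word is a separate case: it gives \<open>[]\<close>, while the general formula
  would give a tableau with one empty row.\<close>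

lemma insert_ones:
  "foldl insert_biletter ([], []) (map (Pair 1) ys) =
    (if ys = [] then ([], []) else ([replicate (length ys) 1], [ys]))"
proof (induction ys rule: rev_induct)
  case (snoc q ys)
  have "new_box_row [] [[Suc 0]] = 0"
    unfolding new_box_row_def by (rule Least_equality) (auto simp: row_length_def)
  then have "insert_biletter ([], []) (1, q) = ([[1]], [[q]])"
    by (simp add: insert_biletter_def add_box_def)
  with snoc show ?case
    using insert_one_one_row[of ys "length ys" q] by auto
qed simp

lemma insert_ones_two:
  "foldl insert_biletter ([], []) (map (Pair 1) ys @ [(2, q)]) =
    ([replicate (length ys) 1 @ [2]], [ys @ [q]])"
proof (cases "ys = []")
  case True
  have "new_box_row [] [[2]] = 0"
    unfolding new_box_row_def by (rule Least_equality) (auto simp: row_length_def)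
  then show ?thesis using True
    by (simp add: insert_biletter_def add_box_def)
next
  case False
  have "new_box_row [replicate (length ys) 1] [replicate (length ys) 1 @ [2]] = 0"
    unfolding new_box_row_def by (rule Least_equality) (auto simp: row_length_def)
  then show ?thesis using False
    unfolding foldl_append insert_ones by (simp add: insert_biletter_def add_box_def)
qed

lemma insert_bump:
  "insert_biletter ([replicate a 1 @ [2]], [ys]) (1, q) = ([replicate (Suc a) 1, [2]], [ys, [q]])"
proof -
  have "{x \<in> set (replicate a (1::nat) @ [2]). 1 < x} = {2}" by auto
  moreover have "takeWhile (\<lambda>x. x \<noteq> 2) (replicate a (1::nat) @ [2]) = replicate a 1"
    by (subst takeWhile_append2) auto
  moreover have "(replicate a (1::nat) @ [2])[a := 1] = replicate (Suc a) 1"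
    by (simp add: list_update_append replicate_append_same)
  ultimately have "row_insert [replicate a 1 @ [2]] 1 = [replicate (Suc a) 1, [2]]"
    by (simp add: Let_def replicate_append_same)
  \<comment> \<open>The bump leaves the first row at length \<open>a + 1\<close>, so the shapes
    first differ in row 1, counted from 0.\<close>
  moreover have "new_box_row [replicate a 1 @ [2]] [replicate (Suc a) 1, [2]] = 1"
    unfolding new_box_row_def
    by (rule Least_equality) (auto simp: row_length_def nth_Cons' intro: Suc_leI split: if_splits)
  ultimately show ?thesis by (simp add: insert_biletter_def add_box_def)
qed

lemma insert_ones_two_rows:
  "foldl insert_biletter ([replicate a 1, [2]], [ys, [q]]) (map (Pair 1) zs) =
    ([replicate (a + length zs) 1, [2]], [ys @ zs, [q]])"
proof (induction zs rule: rev_induct)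
  case (snoc z zs)
  have "new_box_row [replicate b 1, [2]] [replicate (Suc b) 1, [2]] = 0" for b
    unfolding new_box_row_def by (rule Least_equality) (auto simp: row_length_def)
  then have "insert_biletter ([replicate b 1, [2]], [ys', [q]]) (1, z) =
      ([replicate (Suc b) 1, [2]], [ys' @ [z], [q]])" for b ys'
    by (simp add: insert_biletter_def add_box_def replicate_append_same)
  with snoc show ?case by simp
qed simp

text \<open>Only the first 1 after the 2 bumps; later ones extend the first row. Hence
  \<open>z\<close>, the column index of the bumping letter, is the label recorded in the second row,
  while \<open>q\<close> stays in the first.\<close>

lemma insert_single_two:
  "foldl insert_biletter ([], []) (map (Pair 1) ys @ (2, q) # map (Pair 1) (z # zs)) =
    ([replicate (Suc (length ys + length zs)) 1, [2]], [ys @ q # zs, [z]])"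
proof -
  have split: "map (Pair (1::nat)) ys @ (2, q) # map (Pair 1) (z # zs) =
      (map (Pair 1) ys @ [(2, q)]) @ (1, z) # map (Pair 1) zs"
    by simp
  show ?thesis
    unfolding split foldl_append[of _ _ "map (Pair 1) ys @ [(2, q)]"]
    unfolding insert_ones_two foldl_Cons insert_bump insert_ones_two_rows by simp
qed


section \<open>The resulting bitableaux\<close>

lemma z_minor_1: "z_minor [i] [j] = z_var i j"
  unfolding z_minor_def by (subst det_single) auto

lemma z_minor_2: "z_minor [i, i'] [j, j'] = z_var i j * z_var i' j' - z_var i j' * z_var i' j"
proof -
  let ?A = "mat 2 2 (\<lambda>(a, b). z_var ([i, i'] ! a) ([j, j'] ! b))"
  have "det ?A = (\<Sum>r<2. ?A $$ (r, 0) * cofactor ?A r 0)"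
    by (rule laplace_expansion_column) auto
  also have "\<dots> = z_var i j * z_var i' j' - z_var i j' * z_var i' j"
    by (simp add: numeral_2_eq_2 cofactor_def mat_delete_def det_single algebra_simps)
  finally show ?thesis by (simp add: z_minor_def numeral_2_eq_2)
qed

lemma prod_nth: "(\<Prod>c<length xs. f (xs ! c)) = prod_list (map f xs)"
  by (induction xs) (simp_all add: prod.lessThan_Suc_shift del: prod.lessThan_Suc)

lemma bitableau_row:
  assumes "length us = length vs"
  shows "bitableau [us] [vs] = Poly_Mapping.single (word_matrix (zip us vs)) 1"
proof -
  have "bitableau [us] [vs] = (\<Prod>c<length (zip us vs). (\<lambda>(i, j). z_var i j) (zip us vs ! c))"
    using assms by (auto simp: bitableau_def row_length_def tab_column_def z_minor_1 intro!: prod.cong)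
  then show ?thesis by (simp only: prod_nth prod_list_z_var)
qed

text \<open>Only the first column has two boxes. Its 2 by 2 minor produces the two terms, and every
  other column contributes a single variable.\<close>

lemma bitableau_hook:
  assumes "length us = length vs"
  shows "bitableau [u # us, [u']] [v # vs, [v']] =
    Poly_Mapping.single (word_matrix ((u, v) # (u', v') # zip us vs)) 1 -
    Poly_Mapping.single (word_matrix ((u, v') # (u', v) # zip us vs)) 1"
proof -
  have "bitableau [u # us, [u']] [v # vs, [v']] =
      z_minor [u, u'] [v, v'] * (\<Prod>c<length (zip us vs). (\<lambda>(i, j). z_var i j) (zip us vs ! c))"
    using assms
    by (auto simp: bitableau_def row_length_def tab_column_def z_minor_1 prod.lessThan_Suc_shift
        simp del: prod.lessThan_Suc intro!: prod.cong)
  also have "\<dots> = (z_var u v * z_var u' v' - z_var u v' * z_var u' v) *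
      Poly_Mapping.single (word_matrix (zip us vs)) 1"
    by (simp only: prod_nth prod_list_z_var z_minor_2)
  finally show ?thesis
    by (simp add: word_matrix_simps z_var_def left_diff_distrib mult_single add.assoc)
qed


section \<open>The invariant subspace\<close>

text \<open>The index \<open>i\<close> is the column of the 2, counted from 1, so this word belongs
  to the vector with index \<open>i - 1\<close> in the overview. For \<open>i = 1\<close> the range
  \<open>[1..<i]\<close> is empty and column 1 holds \<open>p\<close> ones followed by the
  2.\<close>

definition word :: "nat \<Rightarrow> nat \<Rightarrow> nat \<Rightarrow> (nat \<times> nat) list" where
  "word p k i = map (Pair 1) (replicate p 1 @ [1..<i]) @ (2, i) # map (Pair 1) [Suc i..<Suc k]"

text \<open>With one letter per column after the \<open>p\<close> extra ones, multiplicities can be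
  read off column by column.\<close>

lemma word_alt:
  assumes "i \<in> {1..k}"
  shows "word p k i = replicate p (1, 1) @ map (\<lambda>j. (if j = i then 2 else 1, j)) [1..<Suc k]"
proof -
  have "[1..<Suc k] = [1..<i] @ i # [Suc i..<Suc k]"
    using assms upt_add_eq_append[of 1 i "Suc k - i"] by (simp add: upt_conv_Cons)
  then show ?thesis by (simp add: word_def)
qed

text \<open>The word is already in reading order: columns increase, and in column 1, the only one
  that can hold several letters, the ones precede a possible 2.\<close>

lemma biletters_word:
  assumes "2 \<le> m" "k \<le> n" "i \<in> {1..k}"
  shows "biletters m n (word_matrix (word p k i)) = word p k i"
proof -
  \<comment> \<open>\<open>C j\<close> is the segment read from column \<open>j\<close>; rows from 3
    on and columns beyond \<open>k\<close> turn out to contribute nothing.\<close>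
  define C where "C j = (if j = 1 then replicate p (1, 1) else []) @
    (if j \<le> k then [(if j = i then 2 else 1::nat, j)] else [])" for j :: nat
  have count: "count_list (word p k i) (r, j) =
      (if r = 1 \<and> j = 1 then p else 0) + (if j \<in> {1..k} \<and> r = (if j = i then 2 else 1) then 1 else 0)"
    for r j
  proof -
    have "count_list (map (\<lambda>j. (g j, j)) xs) (r, j) =
        (if j \<in> set xs \<and> r = g j then 1 else 0)" if "distinct xs" for g :: "nat \<Rightarrow> nat" and xs
      using that by (induction xs) auto
    moreover have "count_list (replicate p (1::nat, 1::nat)) (r, j) = (if r = 1 \<and> j = 1 then p else 0)"
      by (induction p) auto
    ultimately show ?thesis
      unfolding word_alt[OF assms(3)] by (auto simp del: upt_Suc)
  qed
  have rows: "[1..<Suc m] = 1 # 2 # [3..<Suc m]"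
    using assms(1) by (simp add: upt_conv_Cons numeral_2_eq_2 numeral_3_eq_3 del: upt_Suc)
  have "concat (map (\<lambda>r. replicate (count_list (word p k i) (r, j)) (r, j)) [3..<Suc m]) = []" for j
    by (auto simp: count)
  then have col: "concat (map (\<lambda>r. replicate (count_list (word p k i) (r, j)) (r, j)) [1..<Suc m]) = C j"
    if "1 \<le> j" for j
    using that unfolding rows by (auto simp: count C_def replicate_append_same)
  have "biletters m n (word_matrix (word p k i)) = concat (map C [1..<Suc n])"
    unfolding biletters_def lookup_word_matrix
    by (intro arg_cong[where f = concat] map_cong refl col) auto
  also have "[1..<Suc n] = 1 # [2..<Suc n]"
    using assms by (simp add: upt_conv_Cons numeral_2_eq_2 del: upt_Suc)
  also have "[2..<Suc n] = [2..<Suc k] @ [Suc k..<Suc n]"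
    using assms upt_add_eq_append[of 2 "Suc k" "n - k"] by (simp del: upt_Suc)
  also have "concat (map C (1 # \<dots>)) = C 1 @ concat (map C [2..<Suc k]) @ concat (map C [Suc k..<Suc n])"
    by simp
  also have "concat (map C [Suc k..<Suc n]) = []"
    using assms by (auto simp: C_def)
  also have "map C [2..<Suc k] = map (\<lambda>j. [(if j = i then 2 else 1, j)]) [2..<Suc k]"
    by (auto simp: C_def)
  also have "C 1 @ concat \<dots> @ [] = word p k i"
    unfolding word_alt[OF assms(3)] using assms
    by (simp add: C_def concat_map_singleton upt_conv_Cons numeral_2_eq_2 del: upt_Suc)
  finally show ?thesis .
qed

lemma zip_replicate_Pair: "length ys = a \<Longrightarrow> zip (replicate a x) ys = map (Pair x) ys"
  by (simp add: zip_replicate1)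

text \<open>The 2 is inserted last and bumps nothing, so both tableaux have one row and the product
  of their 1 by 1 minors is the original monomial.\<close>

lemma RSK_op_word_last:
  assumes "2 \<le> m" "k \<le> n" "1 \<le> k"
  shows "RSK_op m n (Poly_Mapping.single (word_matrix (word p k k)) c) =
    Poly_Mapping.single (word_matrix (word p k k)) c"
proof -
  let ?ys = "replicate p 1 @ [1..<k]"
  have "RSK m n (word_matrix (word p k k)) = foldl insert_biletter ([], []) (word p k k)"
    using assms by (simp add: RSK_def biletters_word)
  also have "\<dots> = ([replicate (length ?ys) 1 @ [2]], [?ys @ [k]])"
    using insert_ones_two[of ?ys k] by (simp add: word_def)
  finally have "RSK m n (word_matrix (word p k k)) = \<dots>" .
  moreover have "zip (replicate (length ?ys) 1 @ [2]) (?ys @ [k]) = word p k k"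
    by (subst zip_append) (simp_all add: zip_replicate_Pair word_def del: length_append)
  ultimately show ?thesis
    by (simp add: RSK_op_single bitableau_row scale_poly_def mult_single)
qed

lemma RSK_op_word_bump:
  assumes "2 \<le> m" "k \<le> n" "1 \<le> i" "i < k"
  shows "RSK_op m n (Poly_Mapping.single (word_matrix (word p k i)) c) =
    Poly_Mapping.single (word_matrix (word p k (Suc i))) c - Poly_Mapping.single (word_matrix (word p k 1)) c"
proof -
  let ?ys = "replicate p 1 @ [1..<i]" and ?zs = "[Suc (Suc i)..<Suc k]"
  define vs where "vs = tl (?ys @ i # ?zs)"
  \<comment> \<open>The first row of the recording tableau starts with 1 even if
    \<open>p = 0\<close>: then either \<open>[1..<i]\<close> starts with 1 or
    \<open>i = 1\<close>.\<close>
  have row: "?ys @ i # ?zs = 1 # vs"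
    using assms(3) by (cases p) (auto simp: vs_def upt_conv_Cons le_less simp del: upt_Suc)
  have len: "length ?ys + length ?zs = length vs"
    using arg_cong[OF row, of length] by simp
  have zs: "[Suc i..<Suc k] = Suc i # ?zs"
    using assms by (simp add: upt_conv_Cons del: upt_Suc)
  have "RSK m n (word_matrix (word p k i)) = foldl insert_biletter ([], []) (word p k i)"
    using assms by (simp add: RSK_def biletters_word)
  also have "\<dots> = ([1 # replicate (length vs) 1, [2]], [1 # vs, [Suc i]])"
    unfolding word_def zs insert_single_two row len by simp
  finally have RSK: "RSK m n (word_matrix (word p k i)) = \<dots>" .
  have range: "[1..<Suc i] = [1..<i] @ [i]"
    using assms by simp
  have range': "[1..<Suc k] = [1..<i] @ i # Suc i # ?zs"
    using assms upt_add_eq_append[of 1 i "Suc k - i"] by (simp add: upt_conv_Cons zs del: upt_Suc)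
  \<comment> \<open>Diagonal term of the minor: the 2 moves to column \<open>Suc i\<close>, and the
    row-1 letters occupy all the other columns.\<close>
  have "mset (1 # vs) = mset (replicate p 1 @ [1..<Suc i] @ ?zs)"
    unfolding row[symmetric] range by simp
  then have "mset (map (Pair (1::nat)) (1 # vs)) = mset (map (Pair 1) (replicate p 1 @ [1..<Suc i] @ ?zs))"
    by (simp only: mset_map)
  then have "mset ((1, 1) # (2, Suc i) # map (Pair 1) vs) = mset (word p k (Suc i))"
    by (simp add: word_def add_mset_commute[of _ "(2, Suc i)"] del: upt_Suc)
  then have 1: "word_matrix ((1, 1) # (2, Suc i) # map (Pair 1) vs) = word_matrix (word p k (Suc i))"
    by (rule word_matrix_cong)
  \<comment> \<open>Antidiagonal term: the 2 moves to column 1. Cancelling one 1 leaves the row-1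
    columns of \<open>word p k 1\<close>.\<close>
  have "mset (1 # Suc i # vs) = mset (replicate p 1 @ [1..<Suc k])"
    using arg_cong[OF row, of mset] unfolding range' by simp
  also have "[1..<Suc k] = 1 # [Suc 1..<Suc k]"
    using assms by (simp add: upt_conv_Cons del: upt_Suc)
  finally have "mset (Suc i # vs) = mset (replicate p 1 @ [Suc 1..<Suc k])"
    by simp
  then have "mset (map (Pair (1::nat)) (Suc i # vs)) = mset (map (Pair 1) (replicate p 1 @ [Suc 1..<Suc k]))"
    by (simp only: mset_map)
  then have "mset ((1, Suc i) # (2, 1) # map (Pair 1) vs) = mset (word p k 1)"
    by (simp add: word_def add_mset_commute[of _ "(2, Suc 0)"] del: upt_Suc)
  then have 2: "word_matrix ((1, Suc i) # (2, 1) # map (Pair 1) vs) = word_matrix (word p k 1)"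
    by (rule word_matrix_cong)
  have "bitableau [1 # replicate (length vs) 1, [2]] [1 # vs, [Suc i]] =
      Poly_Mapping.single (word_matrix (word p k (Suc i))) 1 - Poly_Mapping.single (word_matrix (word p k 1)) 1"
    by (subst bitableau_hook) (simp_all only: zip_replicate_Pair 1 2 length_replicate)
  then show ?thesis
    by (simp add: RSK_op_single RSK scale_poly_def right_diff_distrib mult_single)
qed


section \<open>Eigenvectors\<close>

text \<open>Here \<open>h\<close> is the inverse of \<open>w\<close>, and \<open>h ^ K = w\<close>
  encodes that \<open>w\<close> is a root of unity of order dividing \<open>K + 1\<close>. Comparing
  coefficients forces ratio \<open>h\<close> between neighbours below \<open>K\<close>; the factor
  \<open>w - 1\<close> clears the denominator in the coefficient of \<open>e K\<close>. No division
  occurs, so \<open>w = 1\<close> is included.\<close>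

lemma eigenvector_identity:
  fixes w h :: "'a::comm_ring_1"
  assumes "w * h = 1" "h ^ K = w"
  shows "(\<Sum>i<K. (w - 1) * h ^ i * (e (Suc i) - e 0)) + w\<^sup>2 * e K =
    w * ((\<Sum>i<K. (w - 1) * h ^ i * e i) + w\<^sup>2 * e K)"
proof -
  have shift: "h ^ i = w * h ^ Suc i" for i
    using assms(1) by (simp add: mult.assoc[symmetric])
  \<comment> \<open>Writing \<open>h ^ i\<close> as \<open>w * h ^ Suc i\<close> makes the
    difference telescope to its boundary terms.\<close>
  have "(\<Sum>i<K. h ^ i * e (Suc i)) - w * (\<Sum>i<K. h ^ i * e i) =
      w * (\<Sum>i<K. h ^ Suc i * e (Suc i) - h ^ i * e i)"
    by (subst shift) (simp add: sum_distrib_left sum_subtractf mult.assoc right_diff_distrib)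
  also have "(\<Sum>i<K. h ^ Suc i * e (Suc i) - h ^ i * e i) = w * e K - e 0"
    by (subst sum_lessThan_telescope) (simp add: assms)
  finally have A: "(\<Sum>i<K. h ^ i * e (Suc i)) = w * (\<Sum>i<K. h ^ i * e i) + w * (w * e K - e 0)"
    by (simp add: algebra_simps)
  \<comment> \<open>As \<open>w - 1 = - w * (h - 1)\<close>, the geometric sum is evaluated without
    dividing by \<open>h - 1\<close>.\<close>
  have "(w - 1) * (\<Sum>i<K. h ^ i) = - w * ((h - 1) * (\<Sum>i<K. h ^ i))"
    using assms(1) by (simp add: algebra_simps mult.assoc[symmetric])
  also have "(h - 1) * (\<Sum>i<K. h ^ i) = w - 1"
    using power_diff_1_eq[of h K] assms(2) by simp
  finally have B: "(w - 1) * (\<Sum>i<K. h ^ i) = - w * (w - 1)" .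
  have "(\<Sum>i<K. (w - 1) * h ^ i * (e (Suc i) - e 0)) =
      (w - 1) * (\<Sum>i<K. h ^ i * e (Suc i)) - (w - 1) * (\<Sum>i<K. h ^ i) * e 0"
    by (simp add: sum_distrib_left sum_distrib_right sum_subtractf right_diff_distrib mult.assoc)
  also have "\<dots> = (w - 1) * (w * (\<Sum>i<K. h ^ i * e i) + w * (w * e K - e 0)) + w * (w - 1) * e 0"
    unfolding A B by simp
  also have "\<dots> + w\<^sup>2 * e K = w * ((w - 1) * (\<Sum>i<K. h ^ i * e i) + w\<^sup>2 * e K)"
    by (simp add: algebra_simps power2_eq_square)
  finally show ?thesis by (simp add: sum_distrib_left mult.assoc)
qed

theorem theorem5p1:
  fixes k m n d :: nat
  assumes "k \<ge> 1" and "m \<ge> 2" and "n \<ge> k" and "d \<ge> k"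
  shows "\<forall>\<omega>::complex. \<omega> ^ k = 1 \<longrightarrow> eigenvalue_on (homogeneous_part m n d) (RSK_op m n) \<omega>"
proof (intro allI impI)
  fix \<omega> :: complex
  assume root: "\<omega> ^ k = 1"
  obtain K where k: "k = Suc K" using assms(1) by (cases k) auto
  define \<alpha> where "\<alpha> i = word_matrix (word (d - k) k (Suc i))" for i
  define e :: "nat \<Rightarrow> mat_poly" where "e i = Poly_Mapping.single (\<alpha> i) 1" for i
  \<comment> \<open>Scalars are embedded as constant polynomials, so that the ring identity above
    applies inside \<open>mat_poly\<close>.\<close>
  define C :: "complex \<Rightarrow> mat_poly" where "C = Poly_Mapping.single 0"
  have C_e: "C c * e i = Poly_Mapping.single (\<alpha> i) c" for c i
    by (simp add: C_def e_def mult_single)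
  have C_mult: "C (a * b) = C a * C b" and C_diff: "C (a - b) = C a - C b" and C_1: "C 1 = 1" for a b
    by (simp_all add: C_def mult_single single_diff)
  have C_power: "C (a ^ i) = C a ^ i" for a i
    by (induction i) (simp_all add: C_1 C_mult)
  have "\<omega> \<noteq> 0" using root k by auto
  define \<eta> where "\<eta> = inverse \<omega>"
  have unit: "\<omega> * \<eta> = 1" using \<open>\<omega> \<noteq> 0\<close> by (simp add: \<eta>_def)
  have "\<omega> * \<omega> ^ K = 1" using root k by simp
  then have \<eta>K: "\<eta> ^ K = \<omega>"
    unfolding \<eta>_def power_inverse by (metis inverse_unique mult.commute)
  define f where "f = (\<Sum>i<K. C ((\<omega> - 1) * \<eta> ^ i) * e i) + C (\<omega>\<^sup>2) * e K"

  have step: "RSK_op m n (C c * e i) = C c * (e (Suc i) - e 0)" if "i < K" for c i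
    using RSK_op_word_bump[of m k n "Suc i" "d - k" c] that assms k
    by (simp add: C_e right_diff_distrib \<alpha>_def)
  have last: "RSK_op m n (C c * e K) = C c * e K" for c
    using RSK_op_word_last[of m k n "d - k" c] assms k by (simp add: C_e \<alpha>_def)
  have "RSK_op m n f = (\<Sum>i<K. C ((\<omega> - 1) * \<eta> ^ i) * (e (Suc i) - e 0)) + C (\<omega>\<^sup>2) * e K"
    by (simp add: f_def RSK_op_add RSK_op_sum step last)
  also have "\<dots> = C \<omega> * f"
    unfolding f_def C_mult C_diff C_1 C_power
    by (rule eigenvector_identity) (simp_all add: unit \<eta>K C_1 flip: C_mult C_power)
  finally have eigen: "RSK_op m n f = scale_poly \<omega> f"
    by (simp add: scale_poly_def C_def)

  \<comment> \<open>The variable at \<open>(2, k)\<close> occurs only in the last monomial, so its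
    coefficient in \<open>f\<close> is \<open>\<omega>\<^sup>2\<close>, nonzero also for
    \<open>\<omega> = 1\<close>.\<close>
  have "(2, k) \<in> Poly_Mapping.keys (\<alpha> i) \<longleftrightarrow> i = K" for i
    by (auto simp: \<alpha>_def keys_word_matrix k word_def)
  then have "\<alpha> i \<noteq> \<alpha> K" if "i < K" for i using that by (metis less_irrefl)
  then have "Poly_Mapping.lookup f (\<alpha> K) = \<omega>\<^sup>2"
    by (simp add: f_def C_e lookup_add lookup_sum lookup_single)
  then have "f \<noteq> 0" using \<open>\<omega> \<noteq> 0\<close> by auto

  have "C c * e i \<in> homogeneous_part m n d" if "i \<le> K" for c i
  proof -
    \<comment> \<open>The \<open>d - k\<close> extra ones and one letter in each of the
      \<open>k\<close> columns give degree \<open>d\<close>; this is where \<open>k \<le> d\<close>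
      enters.\<close>
    have "length (word (d - k) k (Suc i)) = d"
      using that k assms by (simp add: word_def del: upt_Suc)
    moreover have "set (word (d - k) k (Suc i)) \<subseteq> {1..m} \<times> {1..n}"
      using that k assms by (auto simp: word_def)
    ultimately show ?thesis
      using single_word_matrix_homogeneous[of "word (d - k) k (Suc i)" m n c] by (auto simp: C_e \<alpha>_def)
  qed
  then have "f \<in> homogeneous_part m n d"
    unfolding f_def by (intro homogeneous_part_add homogeneous_part_sum) auto
  with \<open>f \<noteq> 0\<close> eigen show "eigenvalue_on (homogeneous_part m n d) (RSK_op m n) \<omega>"
    unfolding eigenvalue_on_def by blast
qed

end
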